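(* Let $X \Rightarrow Y$ be any sequent of the calculus $\mathbf{D.NL}_{\Diamond}$. If $\mathbb{V},\upsilon\models X\Rightarrow Y$ for every modal $\mathbb{K}$-algebra $\mathbb{V}$ of finite dimension (over any field $\mathbb{K}$) and every valuation $\upsilon$ on $\mathbb{V}$, then $X\Rightarrow Y$ is derivable in $\mathbf{D.NL}_{\Diamond}$.
   Context: The calculus $\mathbf{D.NL}_{\Diamond}$. Formulas: $A ::= p \mid A/A \mid A\otimes A \mid A\backslash A \mid \Diamond A \mid \blacksquare A$ with $p$ ranging over a set of atomic propositions. Structures: $X ::= A \mid X \hat\otimes X \mid \hat\Diamond X \mid X\check{/}X \mid X\check\backslash X \mid \check\blacksquare X$. Sequents have the form $X\Rightarrow Y$ with $X,Y$ structures. Rules: (Id) $p\Rightarrow p$ for atomic $p$; (Cut) from $X\Rightarrow A$ and $A\Rightarrow Y$ infer $X\Rightarrow Y$; display postulates (each invertible, i.e. usable in both directions): $Y\Rightarrow X\check\backslash Z$ iff $X\hat\otimes Y\Rightarrow Z$ iff $X\Rightarrow Z\check{/}Y$; and $\hat\Diamond X\Rightarrow Y$ iff $X\Rightarrow \check\blacksquare Y$. Logical rules: ($\otimes_L$) from $A\hat\otimes B\Rightarrow X$ infer $A\otimes B\Rightarrow X$; ($\otimes_R$) from $X\Rightarrow A$ and $Y\Rightarrow B$ infer $X\hat\otimes Y\Rightarrow A\otimes B$; ($\backslash_L$) from $X\Rightarrow A$ and $B\Rightarrow Y$ infer $A\backslash B\Rightarrow X\check\backslash Y$; ($\backslash_R$)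 from $X\Rightarrow A\check\backslash B$ infer $X\Rightarrow A\backslash B$; ($/_L$) from $B\Rightarrow Y$ and $X\Rightarrow A$ infer $B/A\Rightarrow Y\check{/}X$; ($/_R$) from $X\Rightarrow B\check{/}A$ infer $X\Rightarrow B/A$; ($\Diamond_L$) from $\hat\Diamond A\Rightarrow X$ infer $\Diamond A\Rightarrow X$; ($\Diamond_R$) from $X\Rightarrow A$ infer $\hat\Diamond X\Rightarrow \Diamond A$; ($\blacksquare_L$) from $A\Rightarrow X$ infer $\blacksquare A\Rightarrow\check\blacksquare X$; ($\blacksquare_R$) from $X\Rightarrow\check\blacksquare A$ infer $X\Rightarrow\blacksquare A$. A $\mathbb{K}$-algebra is a vector space $\mathbb{V}$ over a field $\mathbb{K}$ with a bilinear map $\star:\mathbb{V}\times\mathbb{V}\to\mathbb{V}$ (distributive over $+$ in each argument and $(\alpha u)\star(\beta v)=(\alpha\beta)(u\star v)$). A modal $\mathbb{K}$-algebra is $(\mathbb{V},\star,R)$ with $(\mathbb{V},\star)$ a $\mathbb{K}$-algebra and $R\subseteq V\times V$ such that: (L1R) if $vRu$ and $zRw$ then for all $\gamma,\delta\in\mathbb{K}$ there are $\alpha,\beta\in\mathbb{K}$ with $(\gamma v+\delta z)R(\alpha u+\beta w)$; (L2R) if $tR(\alpha u+\beta v)$ then there exist $\lambda,\mu\in\mathbb{K}$ and $z,w\in V$ with $zRu$, $wRv$ and $\lambda z+\mu w=t$; (L3R) $xR0$ iff $x=0$. For $X\subseteq V$, $[X]$ denotes the linear span of $X$ (with $[\emptyset]=\{0\}$),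 and $\mathcal{S}(\mathbb{V})$ the set of subspaces. The algebra $\mathbb{V}^+=(\mathcal{S}(\mathbb{V}),\subseteq,\otimes,\backslash,/,\Diamond,\blacksquare)$ has $\mathbb{U}\otimes\mathbb{W}=[u\star w\mid u\in\mathbb{U},w\in\mathbb{W}]$, $\mathbb{Z}/\mathbb{W}=[u\mid \forall w\in\mathbb{W}\ u\star w\in\mathbb{Z}]$, $\mathbb{U}\backslash\mathbb{Z}=[w\mid\forall u\in\mathbb{U}\ u\star w\in\mathbb{Z}]$, $\Diamond\mathbb{U}=[v\mid \exists u\in\mathbb{U}\ vRu]$, $\blacksquare\mathbb{W}=[u\mid\forall v\,(vRu\Rightarrow v\in\mathbb{W})]$. A valuation is a map $\upsilon$ from atomic propositions to $\mathcal{S}(\mathbb{V})$, extended homomorphically to formulas and structures $\llbracket-\rrbracket_\upsilon$, interpreting $\otimes,\hat\otimes$ as $\otimes$; $/,\check{/}$ as $/$; $\backslash,\check\backslash$ as $\backslash$; $\Diamond,\hat\Diamond$ as $\Diamond$; $\blacksquare,\check\blacksquare$ as $\blacksquare$. $\mathbb{V},\upsilon\models X\Rightarrow Y$ means $\llbracket X\rrbracket_\upsilon\subseteq\llbracket Y\rrbracket_\upsilon$.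
   Formalization: Sequents X ⇒ Y are required to be polarised (hat connectives only in precedent position, check connectives only in succedent position); without this the claim fails, as p ⊗̂ p ⇒ p ⊗̂ p is valid in every model but not derivable. *)

theory Defs
  imports "Jordan_Normal_Form.Missing_VectorSpace"
begin

section \<open>The display calculus\<close>

text \<open>
  The argument order is that of the infix notation: \<open>Over A B\<close> is $A / B$ and
  \<open>Under A B\<close> is $A \backslash B$; likewise for the structural connectives.
\<close>

datatype 'p formula =
    Atom 'p
  | Over "'p formula" "'p formula"
  | Tensor "'p formula" "'p formula"
  | Under "'p formula" "'p formula"
  | Dia "'p formula"
  | Box "'p formula"

datatype 'p struct =
    Fm "'p formula"
  | STensor "'p struct" "'p struct"
  | SDia "'p struct"
  | SOver "'p struct" "'p struct"
  | SUnder "'p struct" "'p struct"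
  | SBox "'p struct"

inductive derivable :: "'p struct \<Rightarrow> 'p struct \<Rightarrow> bool" (infix "\<turnstile>" 50) where
  Id: "Fm (Atom p) \<turnstile> Fm (Atom p)"
| Cut: "X \<turnstile> Fm A \<Longrightarrow> Fm A \<turnstile> Y \<Longrightarrow> X \<turnstile> Y"
| disp_Under_Tensor: "Y \<turnstile> SUnder X Z \<Longrightarrow> STensor X Y \<turnstile> Z"
| disp_Tensor_Under: "STensor X Y \<turnstile> Z \<Longrightarrow> Y \<turnstile> SUnder X Z"
| disp_Tensor_Over: "STensor X Y \<turnstile> Z \<Longrightarrow> X \<turnstile> SOver Z Y"
| disp_Over_Tensor: "X \<turnstile> SOver Z Y \<Longrightarrow> STensor X Y \<turnstile> Z"
| disp_Dia_Box: "SDia X \<turnstile> Y \<Longrightarrow> X \<turnstile> SBox Y"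
| disp_Box_Dia: "X \<turnstile> SBox Y \<Longrightarrow> SDia X \<turnstile> Y"
| Tensor_L: "STensor (Fm A) (Fm B) \<turnstile> X \<Longrightarrow> Fm (Tensor A B) \<turnstile> X"
| Tensor_R: "X \<turnstile> Fm A \<Longrightarrow> Y \<turnstile> Fm B \<Longrightarrow> STensor X Y \<turnstile> Fm (Tensor A B)"
| Under_L: "X \<turnstile> Fm A \<Longrightarrow> Fm B \<turnstile> Y \<Longrightarrow> Fm (Under A B) \<turnstile> SUnder X Y"
| Under_R: "X \<turnstile> SUnder (Fm A) (Fm B) \<Longrightarrow> X \<turnstile> Fm (Under A B)"
| Over_L: "Fm B \<turnstile> Y \<Longrightarrow> X \<turnstile> Fm A \<Longrightarrow> Fm (Over B A) \<turnstile> SOver Y X"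
| Over_R: "X \<turnstile> SOver (Fm B) (Fm A) \<Longrightarrow> X \<turnstile> Fm (Over B A)"
| Dia_L: "SDia (Fm A) \<turnstile> X \<Longrightarrow> Fm (Dia A) \<turnstile> X"
| Dia_R: "X \<turnstile> Fm A \<Longrightarrow> SDia X \<turnstile> Fm (Dia A)"
| Box_L: "Fm A \<turnstile> X \<Longrightarrow> Fm (Box A) \<turnstile> SBox X"
| Box_R: "X \<turnstile> SBox (Fm A) \<Longrightarrow> X \<turnstile> Fm (Box A)"

text \<open>
  Structural connectives are polarised, as usual in display calculi: those written with
  a hat (\<open>STensor\<close>, \<open>SDia\<close>) occur in precedent position, those written with a check
  (\<open>SOver\<close>, \<open>SUnder\<close>, \<open>SBox\<close>) in succedent position. The calculus only manipulates
  sequents of this shape, so that for instance \<open>STensor X Y \<turnstile> STensor X Y\<close> is never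
  derivable, although it holds in every model.
\<close>

fun precedent :: "'p struct \<Rightarrow> bool" and succedent :: "'p struct \<Rightarrow> bool"
  where
    "precedent (Fm A) = True"
  | "precedent (STensor X Y) = (precedent X \<and> precedent Y)"
  | "precedent (SDia X) = precedent X"
  | "precedent (SOver X Y) = False"
  | "precedent (SUnder X Y) = False"
  | "precedent (SBox X) = False"
  | "succedent (Fm A) = True"
  | "succedent (STensor X Y) = False"
  | "succedent (SDia X) = False"
  | "succedent (SOver X Y) = (succedent X \<and> precedent Y)"
  | "succedent (SUnder X Y) = (precedent X \<and> succedent Y)"
  | "succedent (SBox X) = succedent X"

definition is_sequent :: "'p struct \<Rightarrow> 'p struct \<Rightarrow> bool" where
  "is_sequent X Y \<longleftrightarrow> precedent X \<and> succedent Y"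

lemma derivable_is_sequent: "X \<turnstile> Y \<Longrightarrow> is_sequent X Y"
  by (induction rule: derivable.induct) (auto simp: is_sequent_def)

lemma not_derivable_STensor_refl: "\<not> STensor X Y \<turnstile> STensor X Y"
  by (auto dest: derivable_is_sequent simp: is_sequent_def)


section \<open>Modal algebras over a field\<close>

locale K_algebra = vectorspace K V
  for K :: "('k, 'c) ring_scheme" (structure) and V :: "('k, 'v, 'd) module_scheme" +
  fixes star :: "'v \<Rightarrow> 'v \<Rightarrow> 'v" (infixl "\<star>" 70)
  assumes star_closed: "u \<in> carrier V \<Longrightarrow> v \<in> carrier V \<Longrightarrow> u \<star> v \<in> carrier V"
    and star_add_left: "u \<in> carrier V \<Longrightarrow> v \<in> carrier V \<Longrightarrow> w \<in> carrier V \<Longrightarrow>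
      (u \<oplus>\<^bsub>V\<^esub> v) \<star> w = (u \<star> w) \<oplus>\<^bsub>V\<^esub> (v \<star> w)"
    and star_add_right: "u \<in> carrier V \<Longrightarrow> v \<in> carrier V \<Longrightarrow> w \<in> carrier V \<Longrightarrow>
      u \<star> (v \<oplus>\<^bsub>V\<^esub> w) = (u \<star> v) \<oplus>\<^bsub>V\<^esub> (u \<star> w)"
    and star_smult: "\<alpha> \<in> carrier K \<Longrightarrow> \<beta> \<in> carrier K \<Longrightarrow> u \<in> carrier V \<Longrightarrow> v \<in> carrier V \<Longrightarrow>
      (\<alpha> \<odot>\<^bsub>V\<^esub> u) \<star> (\<beta> \<odot>\<^bsub>V\<^esub> v) = (\<alpha> \<otimes> \<beta>) \<odot>\<^bsub>V\<^esub> (u \<star> v)"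

locale modal_K_algebra = K_algebra K V star
  for K :: "('k, 'c) ring_scheme" (structure) and V :: "('k, 'v, 'd) module_scheme"
    and star :: "'v \<Rightarrow> 'v \<Rightarrow> 'v" (infixl "\<star>" 70) +
  fixes R :: "('v \<times> 'v) set"
  assumes R_carrier: "R \<subseteq> carrier V \<times> carrier V"
    and L1R: "(v, u) \<in> R \<Longrightarrow> (z, w) \<in> R \<Longrightarrow> \<gamma> \<in> carrier K \<Longrightarrow> \<delta> \<in> carrier K \<Longrightarrow>
      \<exists>\<alpha>\<in>carrier K. \<exists>\<beta>\<in>carrier K.
        (\<gamma> \<odot>\<^bsub>V\<^esub> v \<oplus>\<^bsub>V\<^esub> \<delta> \<odot>\<^bsub>V\<^esub> z, \<alpha> \<odot>\<^bsub>V\<^esub> u \<oplus>\<^bsub>V\<^esub> \<beta> \<odot>\<^bsub>V\<^esub> w) \<in> R"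
    and L2R: "u \<in> carrier V \<Longrightarrow> v \<in> carrier V \<Longrightarrow> \<alpha> \<in> carrier K \<Longrightarrow> \<beta> \<in> carrier K \<Longrightarrow>
      (t, \<alpha> \<odot>\<^bsub>V\<^esub> u \<oplus>\<^bsub>V\<^esub> \<beta> \<odot>\<^bsub>V\<^esub> v) \<in> R \<Longrightarrow>
      \<exists>\<kappa>\<in>carrier K. \<exists>\<mu>\<in>carrier K. \<exists>z\<in>carrier V. \<exists>w\<in>carrier V.
        (z, u) \<in> R \<and> (w, v) \<in> R \<and> \<kappa> \<odot>\<^bsub>V\<^esub> z \<oplus>\<^bsub>V\<^esub> \<mu> \<odot>\<^bsub>V\<^esub> w = t"
    and L3R: "x \<in> carrier V \<Longrightarrow> (x, \<zero>\<^bsub>V\<^esub>) \<in> R \<longleftrightarrow> x = \<zero>\<^bsub>V\<^esub>"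
begin

definition tensor_sp :: "'v set \<Rightarrow> 'v set \<Rightarrow> 'v set" where
  "tensor_sp U W = span {u \<star> w | u w. u \<in> U \<and> w \<in> W}"

definition over_sp :: "'v set \<Rightarrow> 'v set \<Rightarrow> 'v set" where
  "over_sp Z W = span {u \<in> carrier V. \<forall>w\<in>W. u \<star> w \<in> Z}"

definition under_sp :: "'v set \<Rightarrow> 'v set \<Rightarrow> 'v set" where
  "under_sp U Z = span {w \<in> carrier V. \<forall>u\<in>U. u \<star> w \<in> Z}"

definition dia_sp :: "'v set \<Rightarrow> 'v set" where
  "dia_sp U = span {v \<in> carrier V. \<exists>u\<in>U. (v, u) \<in> R}"

definition box_sp :: "'v set \<Rightarrow> 'v set" where
  "box_sp W = span {u \<in> carrier V. \<forall>v. (v, u) \<in> R \<longrightarrow> v \<in> W}"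

definition valuation :: "('p \<Rightarrow> 'v set) \<Rightarrow> bool" where
  "valuation \<upsilon> \<longleftrightarrow> (\<forall>p. subspace K (\<upsilon> p) V)"

primrec fm_interp :: "('p \<Rightarrow> 'v set) \<Rightarrow> 'p formula \<Rightarrow> 'v set" where
  "fm_interp \<upsilon> (Atom p) = \<upsilon> p"
| "fm_interp \<upsilon> (Over A B) = over_sp (fm_interp \<upsilon> A) (fm_interp \<upsilon> B)"
| "fm_interp \<upsilon> (Tensor A B) = tensor_sp (fm_interp \<upsilon> A) (fm_interp \<upsilon> B)"
| "fm_interp \<upsilon> (Under A B) = under_sp (fm_interp \<upsilon> A) (fm_interp \<upsilon> B)"
| "fm_interp \<upsilon> (Dia A) = dia_sp (fm_interp \<upsilon> A)"
| "fm_interp \<upsilon> (Box A) = box_sp (fm_interp \<upsilon> A)"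

primrec interp :: "('p \<Rightarrow> 'v set) \<Rightarrow> 'p struct \<Rightarrow> 'v set" where
  "interp \<upsilon> (Fm A) = fm_interp \<upsilon> A"
| "interp \<upsilon> (STensor X Y) = tensor_sp (interp \<upsilon> X) (interp \<upsilon> Y)"
| "interp \<upsilon> (SDia X) = dia_sp (interp \<upsilon> X)"
| "interp \<upsilon> (SOver X Y) = over_sp (interp \<upsilon> X) (interp \<upsilon> Y)"
| "interp \<upsilon> (SUnder X Y) = under_sp (interp \<upsilon> X) (interp \<upsilon> Y)"
| "interp \<upsilon> (SBox X) = box_sp (interp \<upsilon> X)"

definition models :: "('p \<Rightarrow> 'v set) \<Rightarrow> 'p struct \<Rightarrow> 'p struct \<Rightarrow> bool" where
  "models \<upsilon> X Y \<longleftrightarrow> interp \<upsilon> X \<subseteq> interp \<upsilon> Y"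

end

text \<open>
  HOL cannot quantify over all types inside a formula, so validity is relative to
  a type \<open>'k\<close> holding the scalars and a type \<open>'v\<close> holding the vectors. The field and the
  space range over all fields with carrier in \<open>'k\<close> and all finite-dimensional spaces with
  carrier in \<open>'v\<close>. The types are meant to be arbitrary infinite ones: over finite types,
  only finitely many algebras would be considered up to isomorphism.
\<close>

definition fin_dim_valid ::
  "'k itself \<Rightarrow> 'v itself \<Rightarrow> 'p struct \<Rightarrow> 'p struct \<Rightarrow> bool" where
  "fin_dim_valid (_ :: 'k itself) (_ :: 'v itself) X Y \<longleftrightarrow>
    (\<forall>(K :: 'k ring) (V :: ('k, 'v) module) star R \<upsilon>.
      modal_K_algebra K V star R \<longrightarrow> vectorspace.fin_dim K V \<longrightarrow>
      modal_K_algebra.valuation K V \<upsilon> \<longrightarrow> modal_K_algebra.models K V star R \<upsilon> X Y)"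

end

(*
  A formula that is not derivable from another one is refuted on a finite Kripke frame: filter
  the canonical frame, whose points are the formulas, through the finite set of subformulas,
  so that the points become the sets {A in Phi. D |- A}.

  A finite frame W with ternary relation T and binary relation S becomes a modal algebra over
  an infinite field as follows. The basis is W x W, with W identified with Z/m, and
  (y, i) * (z, j) = (i + j, y + z - j) if T (i + j) y z holds, and 0 otherwise. A vector v is
  related to u if each basis vector in the support of v is S-related to one in the support of u.
  Sending a set A of points to the vectors supported on A x W commutes with all operations:
  any T x y z is realised by some pair of basis vectors, even when one factor or the result is
  prescribed, and since the product on indices is cancellative, multiplying a vector by a
  basis vector never cancels terms. (L1R) is where an infinite field is needed: a suitable
  linear combination of u and w has the union of the supports as its support.

  Taking the rationals as field makes all carriers countable, so they embed into the given types.
*)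
theory Submission
  imports Defs "HOL-Library.Countable"
begin

section \<open>Finite Kripke frames\<close>

lemma derivable_refl: "Fm A \<turnstile> Fm A"
  by (induction A) (meson derivable.intros)+

fun fm_of :: "'p struct \<Rightarrow> 'p formula" where
  "fm_of (Fm A) = A"
| "fm_of (STensor X Y) = Tensor (fm_of X) (fm_of Y)"
| "fm_of (SDia X) = Dia (fm_of X)"
| "fm_of (SOver X Y) = Over (fm_of X) (fm_of Y)"
| "fm_of (SUnder X Y) = Under (fm_of X) (fm_of Y)"
| "fm_of (SBox X) = Box (fm_of X)"

text \<open>Residuation for formulas: the rules of the two connectives, cut against identities,
  carry the display postulate over from structures.\<close>

lemma Tensor_Under_iff: "Fm (Tensor A B) \<turnstile> Fm C \<longleftrightarrow> Fm B \<turnstile> Fm (Under A C)"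
  by (meson derivable.intros derivable_refl)

lemma Tensor_Over_iff: "Fm (Tensor A B) \<turnstile> Fm C \<longleftrightarrow> Fm A \<turnstile> Fm (Over C B)"
  by (meson derivable.intros derivable_refl)

lemma Dia_Box_iff: "Fm (Dia A) \<turnstile> Fm B \<longleftrightarrow> Fm A \<turnstile> Fm (Box B)"
  by (meson derivable.intros derivable_refl)

lemma Tensor_mono:
  "Fm A \<turnstile> Fm A' \<Longrightarrow> Fm B \<turnstile> Fm B' \<Longrightarrow> Fm (Tensor A B) \<turnstile> Fm (Tensor A' B')"
  by (meson derivable.intros)

lemma Dia_mono: "Fm A \<turnstile> Fm B \<Longrightarrow> Fm (Dia A) \<turnstile> Fm (Dia B)"
  by (meson derivable.intros)

text \<open>Polarity decides on which side a structure folds into a formula: right rules fold hat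
  connectives, left rules check connectives. Both halves need a joint induction, as
  \<open>SOver\<close> and \<open>SUnder\<close> mix polarities.\<close>

lemma derivable_fm_of:
  "(precedent X \<longrightarrow> X \<turnstile> Fm (fm_of X)) \<and> (succedent X \<longrightarrow> Fm (fm_of X) \<turnstile> X)"
  by (induction X) (auto intro: derivable.intros derivable_refl)

lemma derivable_if_fm_of:
  "is_sequent X Y \<Longrightarrow> Fm (fm_of X) \<turnstile> Fm (fm_of Y) \<Longrightarrow> X \<turnstile> Y"
  using derivable_fm_of[of X] derivable_fm_of[of Y] Cut by (metis is_sequent_def)

lemma (in modal_K_algebra) interp_eq_fm_interp: "interp \<upsilon> X = fm_interp \<upsilon> (fm_of X)"
  by (induction X) simp_all

section \<open>Frame semantics and filtration\<close>

locale finite_frame =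
  fixes W :: "'w set" and T :: "'w \<Rightarrow> 'w \<Rightarrow> 'w \<Rightarrow> bool" and S :: "'w \<Rightarrow> 'w \<Rightarrow> bool"
  assumes finite_W: "finite W"
begin

text \<open>The binary clauses all read \<open>T x y z\<close> with the composite point
  \<open>x\<close> first. \<open>T\<close> and \<open>S\<close> are arbitrary, as the calculus has
  no structural rule that would impose a frame condition.\<close>

primrec sat :: "('p \<Rightarrow> 'w set) \<Rightarrow> 'p formula \<Rightarrow> 'w set" where
  "sat \<nu> (Atom p) = \<nu> p"
| "sat \<nu> (Over A B) = {y \<in> W. \<forall>z\<in>W. \<forall>x\<in>W. z \<in> sat \<nu> B \<longrightarrow> T x y z \<longrightarrow> x \<in> sat \<nu> A}"
| "sat \<nu> (Tensor A B) = {x \<in> W. \<exists>y\<in>W. \<exists>z\<in>W. y \<in> sat \<nu> A \<and> z \<in> sat \<nu> B \<and> T x y z}"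
| "sat \<nu> (Under A B) = {z \<in> W. \<forall>y\<in>W. \<forall>x\<in>W. y \<in> sat \<nu> A \<longrightarrow> T x y z \<longrightarrow> x \<in> sat \<nu> B}"
| "sat \<nu> (Dia A) = {x \<in> W. \<exists>y\<in>W. y \<in> sat \<nu> A \<and> S x y}"
| "sat \<nu> (Box A) = {y \<in> W. \<forall>x\<in>W. S x y \<longrightarrow> x \<in> sat \<nu> A}"

end

primrec subformulas :: "'p formula \<Rightarrow> 'p formula set" where
  "subformulas (Atom p) = {Atom p}"
| "subformulas (Over A B) = insert (Over A B) (subformulas A \<union> subformulas B)"
| "subformulas (Tensor A B) = insert (Tensor A B) (subformulas A \<union> subformulas B)"
| "subformulas (Under A B) = insert (Under A B) (subformulas A \<union> subformulas B)"
| "subformulas (Dia A) = insert (Dia A) (subformulas A)"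
| "subformulas (Box A) = insert (Box A) (subformulas A)"

lemma finite_subformulas: "finite (subformulas A)"
  by (induction A) auto

lemma subformulas_refl: "A \<in> subformulas A"
  by (cases A) auto

text \<open>Stands for the equivalence class of \<open>D\<close> in the filtration: formulas that
  derive the same members of \<open>\<Phi>\<close> are identified.\<close>

definition theory_of :: "'p formula set \<Rightarrow> 'p formula \<Rightarrow> 'p formula set" where
  "theory_of \<Phi> D = {A \<in> \<Phi>. Fm D \<turnstile> Fm A}"

text \<open>Since no connective is disjunctive, the points can be theories of single formulas, and
  each existence condition in the truth lemma has an explicit witness.\<close>

lemma finite_frame_completeness:
  fixes A B :: "'p formula"
  assumes "\<not> Fm A \<turnstile> Fm B"
  obtains W :: "'p formula set set" and T S \<nu> where
    "finite_frame W" "\<And>p. \<nu> p \<subseteq> W"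
    "\<not> finite_frame.sat W T S \<nu> A \<subseteq> finite_frame.sat W T S \<nu> B"
proof -
  define \<Phi> where "\<Phi> = subformulas A \<union> subformulas B"
  define th where "th = theory_of \<Phi>"
  define W where "W = range th"
  \<comment> \<open>the smallest filtration of the canonical frame on all formulas\<close>
  define T where "T x y z \<longleftrightarrow> (\<exists>E C D. x = th E \<and> y = th C \<and> z = th D \<and> Fm E \<turnstile> Fm (Tensor C D))"
    for x y z
  define S where "S x y \<longleftrightarrow> (\<exists>E C. x = th E \<and> y = th C \<and> Fm E \<turnstile> Fm (Dia C))" for x y
  define \<nu> where "\<nu> p = {x \<in> W. Atom p \<in> x}" for p
  have mem_th: "C \<in> th D \<longleftrightarrow> Fm D \<turnstile> Fm C" if "C \<in> \<Phi>" for C D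
    using that by (simp add: th_def theory_of_def)
  have "W \<subseteq> Pow \<Phi>" by (auto simp: W_def th_def theory_of_def)
  moreover have "finite \<Phi>" by (simp add: \<Phi>_def finite_subformulas)
  ultimately have frame: "finite_frame W"
    by (simp add: finite_frame.intro finite_subset)
  interpret finite_frame W T S by (rule frame)
  have th_W: "th D \<in> W" for D by (simp add: W_def)
  have truth: "sat \<nu> C = {x \<in> W. C \<in> x}" if "subformulas C \<subseteq> \<Phi>" for C
    using that
  proof (induction C)
    case (Atom p)
    show ?case by (simp add: \<nu>_def)
  next
    case (Over P Q)
    have \<Phi>: "P \<in> \<Phi>" "Q \<in> \<Phi>" "Over P Q \<in> \<Phi>" using Over.prems subformulas_refl by auto
    have IH: "sat \<nu> P = {x \<in> W. P \<in> x}" "sat \<nu> Q = {x \<in> W. Q \<in> x}" using Over by auto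
    show ?case
    proof (intro Set.set_eqI iffI)
      fix y assume y: "y \<in> sat \<nu> (Over P Q)"
      then have "y \<in> W" by simp
      then obtain C where C: "y = th C" by (auto simp: W_def)
      \<comment> \<open>\<open>Tensor C Q\<close> is the least committed choice of \<open>x\<close>:
        what it derives is exactly what residuation transfers to \<open>C\<close>.\<close>
      have "T (th (Tensor C Q)) y (th Q)" using C derivable_refl by (auto simp: T_def)
      moreover have "th Q \<in> sat \<nu> Q" by (simp add: IH th_W mem_th \<Phi> derivable_refl)
      ultimately have "th (Tensor C Q) \<in> sat \<nu> P" using y th_W by auto
      then have "P \<in> th (Tensor C Q)" by (simp add: IH)
      then show "y \<in> {x \<in> W. Over P Q \<in> x}"
        by (simp add: th_W mem_th \<Phi> C Tensor_Over_iff)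
    next
      fix y assume "y \<in> {x \<in> W. Over P Q \<in> x}"
      \<comment> \<open>\<open>T\<close> supplies its own representatives of the three points; by
        \<open>mem_th\<close>, which members of \<open>\<Phi>\<close> they derive depends on the
        points only.\<close>
      then show "y \<in> sat \<nu> (Over P Q)"
        by (auto simp: IH T_def mem_th \<Phi>)
          (metis \<Phi> mem_th Tensor_Over_iff Tensor_mono derivable_refl Cut)
    qed
  next
    case (Tensor P Q)
    have \<Phi>: "P \<in> \<Phi>" "Q \<in> \<Phi>" "Tensor P Q \<in> \<Phi>" using Tensor.prems subformulas_refl by auto
    have IH: "sat \<nu> P = {x \<in> W. P \<in> x}" "sat \<nu> Q = {x \<in> W. Q \<in> x}" using Tensor by auto
    show ?case
    proof (intro Set.set_eqI iffI)
      fix x assume "x \<in> sat \<nu> (Tensor P Q)"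
      then show "x \<in> {x \<in> W. Tensor P Q \<in> x}"
        by (auto simp: IH T_def mem_th \<Phi>) (metis \<Phi> mem_th Tensor_mono Cut)
    next
      fix x assume x: "x \<in> {x \<in> W. Tensor P Q \<in> x}"
      then have "x \<in> W" by simp
      then obtain E where E: "x = th E" by (auto simp: W_def)
      \<comment> \<open>\<open>E\<close> derives \<open>Tensor P Q\<close>, so the theories of
        \<open>P\<close> and \<open>Q\<close> themselves can serve as the two factors.\<close>
      have "T x (th P) (th Q)" using x by (auto simp: T_def E mem_th \<Phi>)
      moreover have "th P \<in> sat \<nu> P" "th Q \<in> sat \<nu> Q"
        using th_W derivable_refl by (simp_all add: IH mem_th \<Phi>)
      ultimately show "x \<in> sat \<nu> (Tensor P Q)"
        using x th_W by auto
    qed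
  next
    case (Under P Q)
    have \<Phi>: "P \<in> \<Phi>" "Q \<in> \<Phi>" "Under P Q \<in> \<Phi>" using Under.prems subformulas_refl by auto
    have IH: "sat \<nu> P = {x \<in> W. P \<in> x}" "sat \<nu> Q = {x \<in> W. Q \<in> x}" using Under by auto
    show ?case
    proof (intro Set.set_eqI iffI)
      fix z assume z: "z \<in> sat \<nu> (Under P Q)"
      then have "z \<in> W" by simp
      then obtain D where D: "z = th D" by (auto simp: W_def)
      have "T (th (Tensor P D)) (th P) z" using D derivable_refl by (auto simp: T_def)
      moreover have "th P \<in> sat \<nu> P" by (simp add: IH th_W mem_th \<Phi> derivable_refl)
      ultimately have "th (Tensor P D) \<in> sat \<nu> Q" using z th_W by auto
      then have "Q \<in> th (Tensor P D)" by (simp add: IH)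
      then show "z \<in> {x \<in> W. Under P Q \<in> x}"
        by (simp add: th_W mem_th \<Phi> D Tensor_Under_iff)
    next
      fix z assume "z \<in> {x \<in> W. Under P Q \<in> x}"
      then show "z \<in> sat \<nu> (Under P Q)"
        by (auto simp: IH T_def mem_th \<Phi>)
          (metis \<Phi> mem_th Tensor_Under_iff Tensor_mono derivable_refl Cut)
    qed
  next
    case (Dia P)
    have \<Phi>: "P \<in> \<Phi>" "Dia P \<in> \<Phi>" using Dia.prems subformulas_refl by auto
    have IH: "sat \<nu> P = {x \<in> W. P \<in> x}" using Dia by auto
    show ?case
    proof (intro Set.set_eqI iffI)
      fix x assume "x \<in> sat \<nu> (Dia P)"
      then show "x \<in> {x \<in> W. Dia P \<in> x}"
        by (auto simp: IH S_def mem_th \<Phi>) (metis \<Phi> mem_th Dia_mono Cut)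
    next
      fix x assume x: "x \<in> {x \<in> W. Dia P \<in> x}"
      then have "x \<in> W" by simp
      then obtain E where E: "x = th E" by (auto simp: W_def)
      have "S x (th P)" using x by (auto simp: S_def E mem_th \<Phi>)
      moreover have "th P \<in> sat \<nu> P"
        using th_W derivable_refl by (simp_all add: IH mem_th \<Phi>)
      ultimately show "x \<in> sat \<nu> (Dia P)"
        using x th_W by auto
    qed
  next
    case (Box P)
    have \<Phi>: "P \<in> \<Phi>" "Box P \<in> \<Phi>" using Box.prems subformulas_refl by auto
    have IH: "sat \<nu> P = {x \<in> W. P \<in> x}" using Box by auto
    show ?case
    proof (intro Set.set_eqI iffI)
      fix y assume y: "y \<in> sat \<nu> (Box P)"
      then have "y \<in> W" by simp
      then obtain C where C: "y = th C" by (auto simp: W_def)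
      have "S (th (Dia C)) y" using C derivable_refl by (auto simp: S_def)
      then have "P \<in> th (Dia C)" using y th_W by (simp add: IH)
      then show "y \<in> {x \<in> W. Box P \<in> x}"
        by (simp add: th_W mem_th \<Phi> C Dia_Box_iff)
    next
      fix y assume "y \<in> {x \<in> W. Box P \<in> x}"
      then show "y \<in> sat \<nu> (Box P)"
        by (auto simp: IH S_def mem_th \<Phi>)
          (metis \<Phi> mem_th Dia_Box_iff Dia_mono derivable_refl Cut)
    qed
  qed
  have A: "A \<in> \<Phi>" "subformulas A \<subseteq> \<Phi>" and B: "B \<in> \<Phi>" "subformulas B \<subseteq> \<Phi>"
    using subformulas_refl by (auto simp: \<Phi>_def)
  \<comment> \<open>Identity puts \<open>A\<close> into its own theory and the assumption keeps
    \<open>B\<close> out, so the point \<open>th A\<close> refutes the inclusion.\<close>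
  have "th A \<in> sat \<nu> A" "th A \<notin> sat \<nu> B"
    using assms derivable_refl by (simp_all add: truth A B mem_th th_W)
  then have "\<not> sat \<nu> A \<subseteq> sat \<nu> B" by blast
  then show thesis using that[of W \<nu> T S] frame by (auto simp: \<nu>_def)
qed

section \<open>A cancellative product on pairs\<close>

lemma mod_add_left_inj:
  fixes m :: int
  assumes "(i + j) mod m = (i + j') mod m" "j \<in> {0..<m}" "j' \<in> {0..<m}"
  shows "j = j'"
proof -
  have "j mod m = j' mod m"
    using assms(1) by (metis add_diff_cancel_left' mod_diff_left_eq)
  then show ?thesis using assms by simp
qed

text \<open>
  The second components disambiguate: many pairs multiply to a given first component,
  yet the product is cancellative on both sides.
\<close>

locale twisted_product =
  fixes W :: "'w set" and p :: "'w \<times> 'w \<Rightarrow> 'w \<times> 'w \<Rightarrow> 'w \<times> 'w"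
  assumes p_closed: "s \<in> W \<times> W \<Longrightarrow> t \<in> W \<times> W \<Longrightarrow> p s t \<in> W \<times> W"
    and p_inj_right: "s \<in> W \<times> W \<Longrightarrow> t \<in> W \<times> W \<Longrightarrow> t' \<in> W \<times> W \<Longrightarrow> p s t = p s t' \<Longrightarrow> t = t'"
    and p_inj_left: "s \<in> W \<times> W \<Longrightarrow> s' \<in> W \<times> W \<Longrightarrow> t \<in> W \<times> W \<Longrightarrow> p s t = p s' t \<Longrightarrow> s = s'"
    and p_factor: "b \<in> W \<times> W \<Longrightarrow> y \<in> W \<Longrightarrow> z \<in> W \<Longrightarrow>
      \<exists>s\<in>W \<times> W. \<exists>t\<in>W \<times> W. fst s = y \<and> fst t = z \<and> p s t = b"
    and p_solve_left: "t \<in> W \<times> W \<Longrightarrow> y \<in> W \<Longrightarrow> x \<in> W \<Longrightarrow>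
      \<exists>s\<in>W \<times> W. fst s = y \<and> fst (p s t) = x"
    and p_solve_right: "s \<in> W \<times> W \<Longrightarrow> z \<in> W \<Longrightarrow> x \<in> W \<Longrightarrow>
      \<exists>t\<in>W \<times> W. fst t = z \<and> fst (p s t) = x"

text \<open>Over Z/m, the indices \<open>i\<close> and \<open>j\<close> alone determine the first
  component of the product, so \<open>y\<close> and \<open>z\<close> can be prescribed freely; they
  reenter in the second component, which keeps the product injective in each factor.\<close>

lemma twisted_product_exists:
  assumes "finite W"
  shows "\<exists>p. twisted_product W p"
proof -
  define m where "m = int (card W)"
  define J where "J = {0..<m}"
  have "card W = card J" by (simp add: J_def m_def)
  then obtain h where h: "bij_betw h J W"
    using assms finite_same_card_bij[of J W] by (auto simp: J_def)
  define n where "n = inv_into J h"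
  have n: "bij_betw n W J" using h bij_betw_inv_into n_def by blast
  have nJ: "n w \<in> J" if "w \<in> W" for w using n that by (auto simp: bij_betw_def)
  have hW: "h i \<in> W" if "i \<in> J" for i using h that by (auto simp: bij_betw_def)
  have hn [simp]: "h (n w) = w" if "w \<in> W" for w
    using h that by (simp add: n_def bij_betw_inv_into_right)
  have nh [simp]: "n (h i) = i" if "i \<in> J" for i
    using h that by (simp add: n_def bij_betw_inv_into_left)
  have n_inj: "w = w'" if "n w = n w'" "w \<in> W" "w' \<in> W" for w w'
    using that hn by metis
  \<comment> \<open>The element \<open>j\<close> certifies that \<open>m\<close> is positive, so
    that an empty \<open>W\<close> is covered as well.\<close>
  have mod: "i mod m \<in> J" if "j \<in> J" for i j using that by (auto simp: J_def)
  have mod_id: "i mod m = i" if "i \<in> J" for i using that by (auto simp: J_def)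
  \<comment> \<open>The summand \<open>- n j\<close> lets the second component vary with an index:
    \<open>n y + n z\<close> alone would be fixed by \<open>y\<close> and \<open>z\<close>, and
    \<open>p_factor\<close> would fail as soon as \<open>W\<close> has two points.\<close>
  define p where "p = (\<lambda>(y, i) (z, j). (h ((n i + n j) mod m), h ((n y + n z - n j) mod m)))"
  have h_eq: "i mod m = j mod m" if "h (i mod m) = h (j mod m)" "k \<in> J" for i j k
    using that mod nh by metis
  have "twisted_product W p"
  proof
    fix s t assume "s \<in> W \<times> W" "t \<in> W \<times> W"
    then show "p s t \<in> W \<times> W"
      by (auto simp: p_def intro!: hW mod dest: nJ)
  next
    fix s t t' assume W: "s \<in> W \<times> W" "t \<in> W \<times> W" "t' \<in> W \<times> W" and eq: "p s t = p s t'"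
    obtain y i z j z' j' where st: "s = (y, i)" "t = (z, j)" "t' = (z', j')"
      by (cases s; cases t; cases t')
    have J: "n y \<in> J" "n i \<in> J" "n z \<in> J" "n j \<in> J" "n z' \<in> J" "n j' \<in> J"
      using W st nJ by auto
    \<comment> \<open>The first components determine \<open>j\<close>, which then cancels from the
      second components, and these determine \<open>z\<close>.\<close>
    have "(n i + n j) mod m = (n i + n j') mod m"
      using eq h_eq J(1) by (auto simp: p_def st)
    then have "n j = n j'" by (rule mod_add_left_inj) (use J in \<open>auto simp: J_def\<close>)
    then have j: "j = j'" using W st n_inj by auto
    have "(n y + n z - n j) mod m = (n y + n z' - n j) mod m"
      using eq h_eq J(1) by (auto simp: p_def st j)
    then have "(n y - n j + n z) mod m = (n y - n j + n z') mod m"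
      by (simp add: algebra_simps)
    then have "n z = n z'" by (rule mod_add_left_inj) (use J in \<open>auto simp: J_def\<close>)
    then show "t = t'" using W st n_inj j by auto
  next
    fix s s' t assume W: "s \<in> W \<times> W" "s' \<in> W \<times> W" "t \<in> W \<times> W" and eq: "p s t = p s' t"
    obtain y i z j y' i' where st: "s = (y, i)" "t = (z, j)" "s' = (y', i')"
      by (cases s; cases t; cases s')
    have J: "n y \<in> J" "n i \<in> J" "n z \<in> J" "n j \<in> J" "n y' \<in> J" "n i' \<in> J"
      using W st nJ by auto
    have "(n i + n j) mod m = (n i' + n j) mod m"
      using eq h_eq J(1) by (auto simp: p_def st)
    then have "(n j + n i) mod m = (n j + n i') mod m"
      by (simp add: algebra_simps)
    then have "n i = n i'" by (rule mod_add_left_inj) (use J in \<open>auto simp: J_def\<close>)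
    then have i: "i = i'" using W st n_inj by auto
    have "(n y + n z - n j) mod m = (n y' + n z - n j) mod m"
      using eq h_eq J(1) by (auto simp: p_def st)
    then have "(n z - n j + n y) mod m = (n z - n j + n y') mod m"
      by (simp add: algebra_simps)
    then have "n y = n y'" by (rule mod_add_left_inj) (use J in \<open>auto simp: J_def\<close>)
    then show "s = s'" using W st n_inj i by auto
  next
    fix b y z assume W: "b \<in> W \<times> W" "y \<in> W" "z \<in> W"
    obtain x k where b: "b = (x, k)" by (cases b)
    have xk: "x \<in> W" "k \<in> W" using W b by auto
    define j where "j = (n y + n z - n k) mod m"
    define i where "i = (n x - j) mod m"
    have J: "j \<in> J" "i \<in> J" using mod nJ W by (auto simp: i_def j_def)
    have "(i + j) mod m = n x" "(n y + n z - j) mod m = n k"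
      using mod_id nJ xk by (simp_all add: i_def j_def mod_simps)
    then have "p (y, h i) (z, h j) = b"
      using J xk by (simp add: p_def b)
    then show "\<exists>s\<in>W \<times> W. \<exists>t\<in>W \<times> W. fst s = y \<and> fst t = z \<and> p s t = b"
      using W J hW by (intro bexI[of _ "(y, h i)"] bexI[of _ "(z, h j)"]) auto
  next
    fix t y x assume W: "t \<in> W \<times> W" "y \<in> W" "x \<in> W"
    obtain z j where t: "t = (z, j)" by (cases t)
    define i where "i = (n x - n j) mod m"
    have J: "i \<in> J" using mod nJ W by (auto simp: i_def)
    have "(i + n j) mod m = n x" using mod_id nJ W by (simp add: i_def mod_simps)
    then show "\<exists>s\<in>W \<times> W. fst s = y \<and> fst (p s t) = x"
      using W J hW by (intro bexI[of _ "(y, h i)"]) (auto simp: p_def t)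
  next
    fix s z x assume W: "s \<in> W \<times> W" "z \<in> W" "x \<in> W"
    obtain y i where s: "s = (y, i)" by (cases s)
    define j where "j = (n x - n i) mod m"
    have J: "j \<in> J" using mod nJ W by (auto simp: j_def)
    have "(n i + j) mod m = n x" using mod_id nJ W by (simp add: j_def mod_simps)
    then show "\<exists>t\<in>W \<times> W. fst t = z \<and> fst (p s t) = x"
      using W J hW by (intro bexI[of _ "(z, h j)"]) (auto simp: p_def s)
  qed
  then show ?thesis by blast
qed

section \<open>Coordinate spaces\<close>

definition supported :: "'b set \<Rightarrow> ('b \<Rightarrow> 'a::zero) set" where
  "supported B = {\<phi>. \<forall>b. b \<notin> B \<longrightarrow> \<phi> b = 0}"

text \<open>
  The field and the space of coordinate vectors are carried over to arbitrary types
  along the injections \<open>e\<close> and \<open>f\<close>; \<open>d\<close> and \<open>crd\<close> below are their inverses.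
\<close>

locale coordinates =
  fixes e :: "'a::field \<Rightarrow> 'k" and f :: "('b \<Rightarrow> 'a) \<Rightarrow> 'v" and B :: "'b set"
  assumes inj_e: "inj e" and inj_f: "inj_on f (supported B)" and finite_B: "finite B"
begin

definition d :: "'k \<Rightarrow> 'a" where "d = inv_into UNIV e"
definition crd :: "'v \<Rightarrow> 'b \<Rightarrow> 'a" where "crd = inv_into (supported B) f"

lemma d_e [simp]: "d (e a) = a"
  using inj_e by (simp add: d_def)

lemma crd_f [simp]: "\<phi> \<in> supported B \<Longrightarrow> crd (f \<phi>) = \<phi>"
  using inj_f by (simp add: crd_def)

definition scalars :: "'k ring" where
  "scalars = \<lparr>carrier = range e, mult = \<lambda>a b. e (d a * d b), one = e 1,
     zero = e 0, add = \<lambda>a b. e (d a + d b)\<rparr>"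

definition vectors :: "('k, 'v) module" where
  "vectors = \<lparr>carrier = f ` supported B, mult = undefined, one = undefined,
     zero = f (\<lambda>_. 0), add = \<lambda>u v. f (\<lambda>b. crd u b + crd v b),
     smult = \<lambda>a u. f (\<lambda>b. d a * crd u b)\<rparr>"

lemma scalars_sel [simp]:
  "carrier scalars = range e" "a \<otimes>\<^bsub>scalars\<^esub> b = e (d a * d b)" "\<one>\<^bsub>scalars\<^esub> = e 1"
  "\<zero>\<^bsub>scalars\<^esub> = e 0" "a \<oplus>\<^bsub>scalars\<^esub> b = e (d a + d b)"
  by (simp_all add: scalars_def)

lemma vectors_sel [simp]:
  "carrier vectors = f ` supported B" "\<zero>\<^bsub>vectors\<^esub> = f (\<lambda>_. 0)"
  "u \<oplus>\<^bsub>vectors\<^esub> v = f (\<lambda>b. crd u b + crd v b)"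
  "a \<odot>\<^bsub>vectors\<^esub> u = f (\<lambda>b. d a * crd u b)"
  by (simp_all add: vectors_def)

lemma supported_closed [simp]:
  fixes \<phi> \<psi> :: "'b \<Rightarrow> 'a"
  shows "(\<lambda>_. 0) \<in> supported B"
  "\<phi> \<in> supported B \<Longrightarrow> \<psi> \<in> supported B \<Longrightarrow> (\<lambda>b. \<phi> b + \<psi> b) \<in> supported B"
  "\<phi> \<in> supported B \<Longrightarrow> (\<lambda>b. a * \<phi> b) \<in> supported B"
  "\<phi> \<in> supported B \<Longrightarrow> (\<lambda>b. - \<phi> b) \<in> supported B"
  by (simp_all add: supported_def)

lemma f_crd [simp]: "u \<in> f ` supported B \<Longrightarrow> f (crd u) = u"
  by auto

lemma crd_supported [simp]: "u \<in> f ` supported B \<Longrightarrow> crd u \<in> supported B"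
  by auto

lemma crd_zero_outside: "u \<in> f ` supported B \<Longrightarrow> crd u b \<noteq> 0 \<Longrightarrow> b \<in> B"
  using crd_supported[of u] by (auto simp: supported_def simp del: crd_supported)

section \<open>Field and vector space axioms\<close>

lemma scalars_abelian_group: "abelian_group scalars"
proof (rule abelian_groupI)
  fix a assume "a \<in> carrier scalars"
  then show "\<exists>b\<in>carrier scalars. b \<oplus>\<^bsub>scalars\<^esub> a = \<zero>\<^bsub>scalars\<^esub>"
    by (intro bexI[of _ "e (- d a)"]) auto
qed (auto simp: add_ac)

lemma scalars_cring: "cring scalars"
  by (intro cringI scalars_abelian_group comm_monoidI) (auto simp: algebra_simps)

lemma scalars_field: "field scalars"
proof (rule cring.cring_fieldI2[OF scalars_cring])
  show "\<zero>\<^bsub>scalars\<^esub> \<noteq> \<one>\<^bsub>scalars\<^esub>"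
    using inj_e by (simp add: inj_eq)
next
  fix a assume "a \<in> carrier scalars" "a \<noteq> \<zero>\<^bsub>scalars\<^esub>"
  then obtain x where x: "a = e x" "x \<noteq> 0" by auto
  then show "\<exists>b\<in>carrier scalars. a \<otimes>\<^bsub>scalars\<^esub> b = \<one>\<^bsub>scalars\<^esub>"
    by (auto intro!: exI[of _ "inverse x"])
qed

lemma vectors_abelian_group: "abelian_group vectors"
proof (rule abelian_groupI)
  fix u assume "u \<in> carrier vectors"
  then obtain \<phi> where "\<phi> \<in> supported B" "u = f \<phi>" by auto
  then show "\<exists>y\<in>carrier vectors. y \<oplus>\<^bsub>vectors\<^esub> u = \<zero>\<^bsub>vectors\<^esub>"
    by (intro bexI[of _ "f (\<lambda>b. - \<phi> b)"]) simp_all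
qed (auto simp: add_ac)

lemma vectors_vectorspace: "vectorspace scalars vectors"
  unfolding vectorspace_def
  by (intro conjI scalars_field moduleI scalars_cring vectors_abelian_group)
    (auto simp: algebra_simps)

section \<open>Coordinate subspaces and their spans\<close>

sublocale vectorspace scalars vectors
  by (rule vectors_vectorspace)

text \<open>\<open>D\<close> may exceed \<open>B\<close>, since every vector vanishes outside
  \<open>B\<close> anyway; this admits index sets such as \<open>UNIV\<close> and
  \<open>A \<times> UNIV\<close>.\<close>

definition sp :: "'b set \<Rightarrow> 'v set" where
  "sp D = {u \<in> carrier vectors. \<forall>b. b \<notin> D \<longrightarrow> crd u b = 0}"

definition single :: "'b \<Rightarrow> 'v" where
  "single s = f (\<lambda>b. if b = s then 1 else 0)"

lemma single_closed: "s \<in> B \<Longrightarrow> single s \<in> f ` supported B"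
  by (auto simp: single_def supported_def)

lemma crd_single: "s \<in> B \<Longrightarrow> crd (single s) = (\<lambda>b. if b = s then 1 else 0)"
  unfolding single_def by (rule crd_f) (auto simp: supported_def)

lemma subspace_sp: "subspace scalars (sp D) vectors"
  by (intro subspace.intro submodule.intro vectors_vectorspace module_axioms) (auto simp: sp_def)

lemma span_subset_sp: "G \<subseteq> sp D \<Longrightarrow> span G \<subseteq> sp D"
  using span_is_subset subspace_sp by (simp add: subspace_def)

text \<open>The operations on subspaces take spans; this removes the span wherever the spanned set
  is itself a coordinate subspace.\<close>

lemma span_sp: "span (sp D) = sp D"
  using span_subset_sp in_own_span[of "sp D"] by (auto simp: sp_def)

text \<open>A vector is a finite combination of basis vectors, so an inclusion of
  \<open>sp D\<close> in a span need only be tested on the vectors \<open>single b\<close>.\<close>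

lemma sp_subset_span:
  assumes G: "G \<subseteq> carrier vectors" and D: "\<And>b. b \<in> D \<Longrightarrow> b \<in> B \<Longrightarrow> single b \<in> span G"
  shows "sp D \<subseteq> span G"
proof -
  interpret G: submodule scalars "span G" vectors
    using span_is_submodule[OF G] .
  have "\<forall>u\<in>sp D. {b. crd u b \<noteq> 0} \<subseteq> F \<longrightarrow> u \<in> span G" if "finite F" "F \<subseteq> B" for F
    using that
  proof (induction F)
    case empty
    show ?case
    proof (intro ballI impI)
      fix u assume u: "u \<in> sp D" "{b. crd u b \<noteq> 0} \<subseteq> {}"
      then have "crd u = (\<lambda>_. 0)" by auto
      moreover have "f (crd u) = u" using u by (auto simp: sp_def)
      ultimately have "u = \<zero>\<^bsub>vectors\<^esub>" by simp
      then show "u \<in> span G" using G.zero_closed by simp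
    qed
  next
    case (insert s F)
    show ?case
    proof (intro ballI impI)
      fix u assume u: "u \<in> sp D" "{b. crd u b \<noteq> 0} \<subseteq> insert s F"
      \<comment> \<open>\<open>u\<close> without its coordinate at \<open>s\<close>: the induction
        hypothesis applies to the rest, and a multiple of \<open>single s\<close> restores
        \<open>u\<close>.\<close>
      define \<psi> where "\<psi> = (\<lambda>b. if b = s then 0 else crd u b)"
      have uc: "u \<in> f ` supported B" using u by (auto simp: sp_def)
      have \<psi>: "\<psi> \<in> supported B" using crd_zero_outside[OF uc] by (auto simp: supported_def \<psi>_def)
      have "f \<psi> \<in> sp D" using u \<psi> by (auto simp: sp_def \<psi>_def[symmetric])(auto simp: \<psi>_def split: if_splits)
      moreover have "{b. crd (f \<psi>) b \<noteq> 0} \<subseteq> F" using u \<psi> by auto (auto simp: \<psi>_def split: if_splits)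
      ultimately have 1: "f \<psi> \<in> span G" using insert by auto
      show "u \<in> span G"
      proof (cases "crd u s = 0")
        case True
        then have "\<psi> = crd u" by (auto simp: \<psi>_def)
        then show ?thesis using 1 uc by simp
      next
        case False
        have "single s \<in> span G" using D u False insert by (auto simp: sp_def)
        then have 2: "e (crd u s) \<odot>\<^bsub>vectors\<^esub> single s \<in> span G" by (intro G.smult_closed) auto
        have "f \<psi> \<oplus>\<^bsub>vectors\<^esub> (e (crd u s) \<odot>\<^bsub>vectors\<^esub> single s) \<in> span G"
          using 1 2 by (rule G.m_closed)
        moreover have "f \<psi> \<oplus>\<^bsub>vectors\<^esub> (e (crd u s) \<odot>\<^bsub>vectors\<^esub> single s) = u"
        proof -
          have s: "s \<in> B" using insert by auto
          have "(\<lambda>b. crd u s * crd (single s) b) \<in> supported B"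
            using single_closed[OF s] by simp
          then have "f \<psi> \<oplus>\<^bsub>vectors\<^esub> (e (crd u s) \<odot>\<^bsub>vectors\<^esub> single s)
            = f (\<lambda>b. \<psi> b + crd u s * crd (single s) b)"
            using \<psi> by simp
          also have "(\<lambda>b. \<psi> b + crd u s * crd (single s) b) = crd u"
            by (auto simp: \<psi>_def crd_single[OF s])
          finally show ?thesis using uc by simp
        qed
        ultimately show ?thesis by simp
      qed
    qed
  qed
  from this[OF finite_B] show ?thesis
    using crd_zero_outside by (fastforce simp: sp_def)
qed

lemma fin_dim_vectors: fin_dim
proof -
  have G: "single ` B \<subseteq> carrier vectors" using single_closed by auto
  have "sp UNIV \<subseteq> span (single ` B)"
    using in_own_span[OF G] by (intro sp_subset_span[OF G]) auto
  moreover have "sp UNIV = carrier vectors" by (auto simp: sp_def)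
  ultimately have "span (single ` B) = carrier vectors"
    using span_is_subset2[OF G] by auto
  then show ?thesis unfolding fin_dim_def using G finite_B by blast
qed

end

section \<open>The modal algebra of a finite frame\<close>

text \<open>
  The coordinates are indexed by pairs, which the simplifier must not take apart:
  the twisted product acts on whole indices.
\<close>

declare split_paired_All [simp del] split_paired_Ex [simp del]

section \<open>Product, accessibility and the axioms of a modal algebra\<close>

locale frame_algebra =
  finite_frame W T S + twisted_product W p + coordinates e f "W \<times> W"
  for W :: "'w set" and T S p and e :: "'a::field \<Rightarrow> 'k"
    and f :: "('w \<times> 'w \<Rightarrow> 'a) \<Rightarrow> 'v" +
  assumes infinite_scalars: "infinite (UNIV :: 'a set)"
begin

text \<open>Bilinear extension of the product of indices, cut down to 0 where \<open>T\<close> fails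
  for the points involved.\<close>

definition mul :: "('w \<times> 'w \<Rightarrow> 'a) \<Rightarrow> ('w \<times> 'w \<Rightarrow> 'a) \<Rightarrow> 'w \<times> 'w \<Rightarrow> 'a" where
  "mul \<phi> \<psi> b = (\<Sum>s\<in>W \<times> W. \<Sum>t\<in>W \<times> W.
     if p s t = b \<and> T (fst b) (fst s) (fst t) then \<phi> s * \<psi> t else 0)"

definition star :: "'v \<Rightarrow> 'v \<Rightarrow> 'v" where
  "star u v = f (mul (crd u) (crd v))"

text \<open>Coefficients are ignored on purpose, only supports count; the zero vector has empty
  support, which yields (L3R).\<close>

definition acc :: "('v \<times> 'v) set" where
  "acc = {(v, u). v \<in> carrier vectors \<and> u \<in> carrier vectors \<and>
     (\<forall>b. crd v b \<noteq> 0 \<longrightarrow> (\<exists>c. crd u c \<noteq> 0 \<and> S (fst b) (fst c)))}"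

lemma accD:
  "(v, u) \<in> acc \<Longrightarrow> crd v b \<noteq> 0 \<Longrightarrow> \<exists>c. crd u c \<noteq> 0 \<and> S (fst b) (fst c)"
  by (simp add: acc_def)

lemma mul_nonzeroE:
  assumes "mul \<phi> \<psi> b \<noteq> 0"
  obtains s t where "s \<in> W \<times> W" "t \<in> W \<times> W" "p s t = b" "T (fst b) (fst s) (fst t)"
    "\<phi> s \<noteq> 0" "\<psi> t \<noteq> 0"
proof -
  obtain s where s: "s \<in> W \<times> W" "(\<Sum>t\<in>W \<times> W.
      if p s t = b \<and> T (fst b) (fst s) (fst t) then \<phi> s * \<psi> t else 0) \<noteq> 0"
    using assms unfolding mul_def by (rule sum.not_neutral_contains_not_neutral)
  obtain t where t: "t \<in> W \<times> W"
      "(if p s t = b \<and> T (fst b) (fst s) (fst t) then \<phi> s * \<psi> t else 0) \<noteq> 0"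
    using s(2) by (rule sum.not_neutral_contains_not_neutral)
  show thesis using that[of s t] s t by (auto split: if_splits)
qed

lemma mul_supported [simp]: "mul \<phi> \<psi> \<in> supported (W \<times> W)"
proof -
  have "mul \<phi> \<psi> b = 0" if b: "b \<notin> W \<times> W" for b
  proof (rule ccontr)
    assume "mul \<phi> \<psi> b \<noteq> 0"
    then show False by (rule mul_nonzeroE) (use b p_closed in blast)
  qed
  then show ?thesis by (simp add: supported_def)
qed

lemma crd_star [simp]: "crd (star u v) = mul (crd u) (crd v)"
  by (simp add: star_def)

lemma mul_add_left: "mul (\<lambda>b. \<phi> b + \<phi>' b) \<psi> = (\<lambda>b. mul \<phi> \<psi> b + mul \<phi>' \<psi> b)"
  unfolding mul_def sum.distrib[symmetric]
  by (intro ext sum.cong refl) (auto simp: algebra_simps)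

lemma mul_add_right: "mul \<phi> (\<lambda>b. \<psi> b + \<psi>' b) = (\<lambda>b. mul \<phi> \<psi> b + mul \<phi> \<psi>' b)"
  unfolding mul_def sum.distrib[symmetric]
  by (intro ext sum.cong refl) (auto simp: algebra_simps)

lemma mul_smult: "mul (\<lambda>b. x * \<phi> b) (\<lambda>b. y * \<psi> b) = (\<lambda>b. x * y * mul \<phi> \<psi> b)"
  unfolding mul_def sum_distrib_left
  by (intro ext sum.cong refl) (auto simp: algebra_simps)

text \<open>By right cancellation, \<open>(s, t)\<close> is the only pair with first factor
  \<open>s\<close> that reaches the index \<open>p s t\<close>, so multiplying by
  \<open>single s\<close> moves coefficients without ever adding two of them. This lets the
  residuals detect a single bad coordinate.\<close>

lemma mul_single_left:
  assumes s: "s \<in> W \<times> W" and t: "t \<in> W \<times> W"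
  shows "mul (crd (single s)) \<psi> (p s t) =
    (if T (fst (p s t)) (fst s) (fst t) then \<psi> t else 0)"
proof -
  have "mul (crd (single s)) \<psi> (p s t) =
    (\<Sum>s'\<in>W \<times> W. \<Sum>t'\<in>W \<times> W. if t' = t then if s' = s then
      (if T (fst (p s t)) (fst s) (fst t) then \<psi> t else 0) else 0 else 0)"
    unfolding mul_def crd_single[OF s]
  proof (intro sum.cong refl)
    fix s' t' assume "s' \<in> W \<times> W" "t' \<in> W \<times> W"
    then show "(if p s' t' = p s t \<and> T (fst (p s t)) (fst s') (fst t')
        then (if s' = s then 1 else 0) * \<psi> t' else 0) =
      (if t' = t then if s' = s then
        (if T (fst (p s t)) (fst s) (fst t) then \<psi> t else 0) else 0 else 0)"
      using p_inj_right[OF s _ t] by (cases "s' = s") auto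
  qed
  also have "\<dots> = (if T (fst (p s t)) (fst s) (fst t) then \<psi> t else 0)"
    using s t finite_B by (simp add: sum.delta)
  finally show ?thesis .
qed

lemma mul_single_right:
  assumes s: "s \<in> W \<times> W" and t: "t \<in> W \<times> W"
  shows "mul \<phi> (crd (single t)) (p s t) =
    (if T (fst (p s t)) (fst s) (fst t) then \<phi> s else 0)"
proof -
  have "mul \<phi> (crd (single t)) (p s t) =
    (\<Sum>s'\<in>W \<times> W. \<Sum>t'\<in>W \<times> W. if t' = t then if s' = s then
      (if T (fst (p s t)) (fst s) (fst t) then \<phi> s else 0) else 0 else 0)"
    unfolding mul_def crd_single[OF t]
  proof (intro sum.cong refl)
    fix s' t' assume "s' \<in> W \<times> W" "t' \<in> W \<times> W"
    then show "(if p s' t' = p s t \<and> T (fst (p s t)) (fst s') (fst t')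
        then \<phi> s' * (if t' = t then 1 else 0) else 0) =
      (if t' = t then if s' = s then
        (if T (fst (p s t)) (fst s) (fst t) then \<phi> s else 0) else 0 else 0)"
      using p_inj_left[OF _ s t] by (cases "t' = t") auto
  qed
  also have "\<dots> = (if T (fst (p s t)) (fst s) (fst t) then \<phi> s else 0)"
    using s t finite_B by (simp add: sum.delta)
  finally show ?thesis .
qed

lemma star_single:
  assumes s: "s \<in> W \<times> W" and t: "t \<in> W \<times> W" and T: "T (fst (p s t)) (fst s) (fst t)"
  shows "star (single s) (single t) = single (p s t)"
proof -
  have "mul (crd (single s)) (crd (single t)) b = (if b = p s t then 1 else 0)" for b
  proof (cases "b = p s t")
    case True
    then show ?thesis using mul_single_left[OF s t] T crd_single[OF t] by simp
  next
    case False
    have "mul (crd (single s)) (crd (single t)) b = 0"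
    proof (rule ccontr)
      assume "mul (crd (single s)) (crd (single t)) b \<noteq> 0"
      then show False
        by (rule mul_nonzeroE) (use False in \<open>auto simp: crd_single s t split: if_splits\<close>)
    qed
    then show ?thesis using False by simp
  qed
  then have "mul (crd (single s)) (crd (single t)) = (\<lambda>b. if b = p s t then 1 else 0)"
    by blast
  then show ?thesis by (simp add: star_def single_def[of "p s t"])
qed

lemma modal_K_algebra_vectors: "modal_K_algebra scalars vectors star acc"
proof
  fix u v w assume "u \<in> carrier vectors" "v \<in> carrier vectors" "w \<in> carrier vectors"
  then show "star (u \<oplus>\<^bsub>vectors\<^esub> v) w = star u w \<oplus>\<^bsub>vectors\<^esub> star v w"
    and "star u (v \<oplus>\<^bsub>vectors\<^esub> w) = star u v \<oplus>\<^bsub>vectors\<^esub> star u w"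
    by (simp_all add: star_def mul_add_left mul_add_right)
next
  fix u v \<alpha> \<beta> assume "\<alpha> \<in> carrier scalars" "\<beta> \<in> carrier scalars"
    "u \<in> carrier vectors" "v \<in> carrier vectors"
  then show "star (\<alpha> \<odot>\<^bsub>vectors\<^esub> u) (\<beta> \<odot>\<^bsub>vectors\<^esub> v) =
      (\<alpha> \<otimes>\<^bsub>scalars\<^esub> \<beta>) \<odot>\<^bsub>vectors\<^esub> star u v"
    by (simp add: star_def mul_smult)
next
  fix v u z w \<gamma> \<delta>
  assume R: "(v, u) \<in> acc" "(z, w) \<in> acc" and "\<gamma> \<in> carrier scalars" "\<delta> \<in> carrier scalars"
  have V: "v \<in> f ` supported (W \<times> W)" "u \<in> f ` supported (W \<times> W)"
    "z \<in> f ` supported (W \<times> W)" "w \<in> f ` supported (W \<times> W)"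
    using R by (simp_all add: acc_def)
  \<comment> \<open>A scalar \<open>y\<close> outside this finite set makes the support of \<open>u + y w\<close> the union of
    the supports of \<open>u\<close> and \<open>w\<close>; division by zero only adds \<open>0\<close> to the set.\<close>
  have "finite (insert 0 ((\<lambda>b. - crd u b / crd w b) ` (W \<times> W)))" using finite_B by simp
  then obtain y where y: "y \<notin> insert 0 ((\<lambda>b. - crd u b / crd w b) ` (W \<times> W))"
    using ex_new_if_finite[OF infinite_scalars] by blast
  have nz: "crd u b + y * crd w b \<noteq> 0" if "crd u b \<noteq> 0 \<or> crd w b \<noteq> 0" for b
  proof (cases "crd w b = 0")
    case False
    then have "b \<in> W \<times> W" using crd_zero_outside[OF V(4)] by blast
    then have "y \<noteq> - crd u b / crd w b" using y by blast
    with False show ?thesis by (simp add: field_simps add_eq_0_iff)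
  qed (use that in simp)
  \<comment> \<open>Neither coefficient on the right depends on \<open>\<gamma>\<close> or
    \<open>\<delta>\<close>: the support of the left-hand combination lies within the union of the
    supports of \<open>v\<close> and \<open>z\<close>.\<close>
  have "(\<gamma> \<odot>\<^bsub>vectors\<^esub> v \<oplus>\<^bsub>vectors\<^esub> \<delta> \<odot>\<^bsub>vectors\<^esub> z, e 1 \<odot>\<^bsub>vectors\<^esub> u \<oplus>\<^bsub>vectors\<^esub> e y \<odot>\<^bsub>vectors\<^esub> w) \<in> acc"
  proof -
    have "\<exists>c. crd u c + y * crd w c \<noteq> 0 \<and> S (fst b) (fst c)"
      if b: "d \<gamma> * crd v b + d \<delta> * crd z b \<noteq> 0" for b
    proof -
      from b have "crd v b \<noteq> 0 \<or> crd z b \<noteq> 0" by auto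
      then obtain c where "crd u c \<noteq> 0 \<or> crd w c \<noteq> 0" "S (fst b) (fst c)"
        using accD[OF R(1)] accD[OF R(2)] by blast
      then show ?thesis using nz by blast
    qed
    then show ?thesis using V by (simp add: acc_def)
  qed
  then show "\<exists>\<alpha>\<in>carrier scalars. \<exists>\<beta>\<in>carrier scalars.
      (\<gamma> \<odot>\<^bsub>vectors\<^esub> v \<oplus>\<^bsub>vectors\<^esub> \<delta> \<odot>\<^bsub>vectors\<^esub> z, \<alpha> \<odot>\<^bsub>vectors\<^esub> u \<oplus>\<^bsub>vectors\<^esub> \<beta> \<odot>\<^bsub>vectors\<^esub> w) \<in> acc"
    by (intro bexI[of _ "e 1"] bexI[of _ "e y"]) simp_all
next
  fix u v \<alpha> \<beta> t
  assume V: "u \<in> carrier vectors" "v \<in> carrier vectors"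
    and "\<alpha> \<in> carrier scalars" "\<beta> \<in> carrier scalars"
    and t: "(t, \<alpha> \<odot>\<^bsub>vectors\<^esub> u \<oplus>\<^bsub>vectors\<^esub> \<beta> \<odot>\<^bsub>vectors\<^esub> v) \<in> acc"
  \<comment> \<open>For (L2R), \<open>t\<close> is split by coordinates: those that see the support
    of \<open>u\<close> go to \<open>\<zeta>\<close>, the others to \<open>\<omega>\<close>. Where
    \<open>u\<close> vanishes, a nonzero coordinate of the combination comes from \<open>v\<close>,
    so \<open>\<omega>\<close> is related to \<open>v\<close>.\<close>
  define Q where "Q b \<longleftrightarrow> (\<exists>c. crd u c \<noteq> 0 \<and> S (fst b) (fst c))" for b :: "'w \<times> 'w"
  define \<zeta> where "\<zeta> b = (if Q b then crd t b else 0)" for b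
  define \<omega> where "\<omega> b = (if Q b then 0 else crd t b)" for b
  have tV: "t \<in> f ` supported (W \<times> W)" using t by (simp add: acc_def)
  then have "crd t \<in> supported (W \<times> W)" by simp
  then have supp: "\<zeta> \<in> supported (W \<times> W)" "\<omega> \<in> supported (W \<times> W)"
    by (auto simp: supported_def \<zeta>_def \<omega>_def)
  have "(f \<zeta>, u) \<in> acc"
    using V supp by (auto simp: acc_def \<zeta>_def Q_def split: if_splits)
  moreover have "(f \<omega>, v) \<in> acc"
  proof -
    have "\<exists>c. crd v c \<noteq> 0 \<and> S (fst b) (fst c)" if b: "\<omega> b \<noteq> 0" for b
    proof -
      have "crd t b \<noteq> 0" "\<not> Q b" using b by (auto simp: \<omega>_def split: if_splits)
      then obtain c where c: "d \<alpha> * crd u c + d \<beta> * crd v c \<noteq> 0" "S (fst b) (fst c)"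
        using t V by (auto simp: acc_def)
      moreover have "crd u c = 0" using \<open>\<not> Q b\<close> c(2) by (auto simp: Q_def)
      ultimately show ?thesis by auto
    qed
    then show ?thesis using V supp by (simp add: acc_def)
  qed
  moreover have "e 1 \<odot>\<^bsub>vectors\<^esub> f \<zeta> \<oplus>\<^bsub>vectors\<^esub> e 1 \<odot>\<^bsub>vectors\<^esub> f \<omega> = t"
  proof -
    have "(\<lambda>b. \<zeta> b + \<omega> b) = crd t" by (auto simp: \<zeta>_def \<omega>_def)
    then show ?thesis using supp tV by simp
  qed
  ultimately show "\<exists>\<kappa>\<in>carrier scalars. \<exists>\<mu>\<in>carrier scalars.
      \<exists>z\<in>carrier vectors. \<exists>w\<in>carrier vectors. (z, u) \<in> acc \<and> (w, v) \<in> acc \<and>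
      \<kappa> \<odot>\<^bsub>vectors\<^esub> z \<oplus>\<^bsub>vectors\<^esub> \<mu> \<odot>\<^bsub>vectors\<^esub> w = t"
    using supp by (intro bexI[of _ "e 1"] bexI[of _ "f \<zeta>"] bexI[of _ "f \<omega>"]) simp_all
next
  fix x assume x: "x \<in> carrier vectors"
  show "(x, \<zero>\<^bsub>vectors\<^esub>) \<in> acc \<longleftrightarrow> x = \<zero>\<^bsub>vectors\<^esub>"
  proof
    assume "(x, \<zero>\<^bsub>vectors\<^esub>) \<in> acc"
    then have "crd x = (\<lambda>_. 0)" by (auto simp: acc_def)
    moreover have "f (crd x) = x" using x by simp
    ultimately show "x = \<zero>\<^bsub>vectors\<^esub>" by simp
  qed (simp add: acc_def)
next
  show "star u v \<in> carrier vectors" for u v by (simp add: star_def)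
  show "acc \<subseteq> carrier vectors \<times> carrier vectors" unfolding acc_def by blast
qed

section \<open>Embedding sets of points into the subspaces\<close>

sublocale modal_K_algebra scalars vectors star acc
  by (rule modal_K_algebra_vectors)

text \<open>A point stands for all basis vectors whose index has it as first component; the second
  component stays free, as it serves the product only.\<close>

definition over_points :: "'w set \<Rightarrow> 'v set" where
  "over_points A = sp (A \<times> UNIV)"

lemma mem_over_points:
  "u \<in> over_points A \<longleftrightarrow> u \<in> f ` supported (W \<times> W) \<and> (\<forall>b. crd u b \<noteq> 0 \<longrightarrow> fst b \<in> A)"
  unfolding over_points_def sp_def by (auto simp: mem_Times_iff)

lemma over_pointsD: "u \<in> over_points A \<Longrightarrow> crd u b \<noteq> 0 \<Longrightarrow> fst b \<in> A"
  unfolding mem_over_points by blast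

lemma single_mem_over_points:
  "s \<in> W \<times> W \<Longrightarrow> single s \<in> over_points A \<longleftrightarrow> fst s \<in> A"
  using single_closed by (auto simp: mem_over_points crd_single)

lemma span_over_points: "span (over_points A) = over_points A"
  by (simp add: over_points_def span_sp)

text \<open>A nonzero coordinate of a product comes from nonzero coordinates of both factors, so it
  lies over \<open>?C\<close>; conversely, every basis vector over \<open>?C\<close> is itself a
  product of two basis vectors.\<close>

lemma tensor_sp_over_points:
  "tensor_sp (over_points A) (over_points B) =
     over_points {x \<in> W. \<exists>y\<in>W. \<exists>z\<in>W. y \<in> A \<and> z \<in> B \<and> T x y z}" (is "_ = over_points ?C")
proof
  have *: "star u w \<in> over_points ?C" if "u \<in> over_points A" "w \<in> over_points B" for u w
    unfolding mem_over_points
  proof (intro conjI allI impI)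
    show "star u w \<in> f ` supported (W \<times> W)" by (simp add: star_def)
  next
    fix b assume "crd (star u w) b \<noteq> 0"
    then have "mul (crd u) (crd w) b \<noteq> 0" by simp
    then obtain s t where st: "s \<in> W \<times> W" "t \<in> W \<times> W" "p s t = b" "T (fst b) (fst s) (fst t)"
      "crd u s \<noteq> 0" "crd w t \<noteq> 0" by (rule mul_nonzeroE)
    then have "fst s \<in> A" "fst t \<in> B" using that over_pointsD by blast+
    moreover have "fst s \<in> W" "fst t \<in> W" "fst b \<in> W"
      using st(1,2) p_closed[OF st(1,2)] st(3) by auto
    ultimately show "fst b \<in> ?C" using st(4) by blast
  qed
  then show "tensor_sp (over_points A) (over_points B) \<subseteq> over_points ?C"
    unfolding tensor_sp_def over_points_def by (intro span_subset_sp) auto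
  have G: "{star u w |u w. u \<in> over_points A \<and> w \<in> over_points B} \<subseteq> carrier vectors"
    by (auto simp: star_def)
  show "over_points ?C \<subseteq> tensor_sp (over_points A) (over_points B)"
    unfolding tensor_sp_def over_points_def[of ?C]
  proof (rule sp_subset_span[OF G])
    fix b assume b: "b \<in> ?C \<times> UNIV" "b \<in> W \<times> W"
    then obtain y z where yz: "y \<in> W" "z \<in> W" "y \<in> A" "z \<in> B" "T (fst b) y z" by auto
    \<comment> \<open>\<open>p_factor\<close> prescribes the whole index \<open>b\<close>, not just
      its point, because every basis vector over the point must be spanned.\<close>
    then obtain s t where st: "s \<in> W \<times> W" "t \<in> W \<times> W" "fst s = y" "fst t = z" "p s t = b"
      using p_factor[OF b(2)] by meson
    then have "single b = star (single s) (single t)" using yz by (simp add: star_single)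
    moreover have "single s \<in> over_points A" "single t \<in> over_points B"
      using st yz by (simp_all add: single_mem_over_points)
    ultimately show "single b \<in> span {star u w |u w. u \<in> over_points A \<and> w \<in> over_points B}"
      using in_own_span[OF G] by blast
  qed
qed

text \<open>The set under the span is already a coordinate subspace. If a coordinate
  \<open>t\<close> of \<open>w\<close> violated the condition at \<open>x\<close>, a basis vector
  over \<open>y\<close> would carry it to a coordinate over \<open>x\<close>, where nothing can
  cancel it.\<close>

lemma under_sp_over_points:
  "under_sp (over_points A) (over_points B) =
     over_points {z \<in> W. \<forall>y\<in>W. \<forall>x\<in>W. y \<in> A \<longrightarrow> T x y z \<longrightarrow> x \<in> B}" (is "_ = over_points ?C")
proof -
  have "{w \<in> carrier vectors. \<forall>u\<in>over_points A. star u w \<in> over_points B} = over_points ?C"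
  proof (intro Set.set_eqI iffI)
    fix w assume w: "w \<in> {w \<in> carrier vectors. \<forall>u\<in>over_points A. star u w \<in> over_points B}"
    then have wV: "w \<in> f ` supported (W \<times> W)" by simp
    have "x \<in> B" if t: "crd w t \<noteq> 0" and yx: "y \<in> W" "x \<in> W" "y \<in> A" "T x y (fst t)" for t y x
    proof -
      have tW: "t \<in> W \<times> W" using crd_zero_outside[OF wV t] .
      obtain s where s: "s \<in> W \<times> W" "fst s = y" "fst (p s t) = x"
        using p_solve_left[OF tW yx(1,2)] by blast
      have "star (single s) w \<in> over_points B"
        using w s yx by (simp add: single_mem_over_points)
      moreover have "crd (star (single s) w) (p s t) \<noteq> 0"
        using mul_single_left[OF s(1) tW] s yx t by simp
      ultimately show ?thesis using s(3) over_pointsD by blast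
    qed
    then show "w \<in> over_points ?C"
      using wV crd_zero_outside[OF wV] by (force simp: mem_over_points)
  next
    fix w assume w: "w \<in> over_points ?C"
    have "star u w \<in> over_points B" if u: "u \<in> over_points A" for u
      unfolding mem_over_points
    proof (intro conjI allI impI)
      show "star u w \<in> f ` supported (W \<times> W)" by (simp add: star_def)
    next
      fix b assume "crd (star u w) b \<noteq> 0"
      then have "mul (crd u) (crd w) b \<noteq> 0" by simp
      then obtain s t where st: "s \<in> W \<times> W" "t \<in> W \<times> W" "p s t = b" "T (fst b) (fst s) (fst t)"
        "crd u s \<noteq> 0" "crd w t \<noteq> 0" by (rule mul_nonzeroE)
      then have "fst s \<in> A" "fst t \<in> ?C" using u w over_pointsD by blast+
      moreover have "fst b \<in> W" using p_closed[OF st(1,2)] st(3) by auto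
      ultimately show "fst b \<in> B" using st by auto
    qed
    then show "w \<in> {w \<in> carrier vectors. \<forall>u\<in>over_points A. star u w \<in> over_points B}"
      using w by (simp add: mem_over_points)
  qed
  then show ?thesis by (simp only: under_sp_def span_over_points)
qed

text \<open>The mirror image of the previous argument, now with \<open>p_solve_right\<close> and
  \<open>mul_single_right\<close>.\<close>

lemma over_sp_over_points:
  "over_sp (over_points A) (over_points B) =
     over_points {y \<in> W. \<forall>z\<in>W. \<forall>x\<in>W. z \<in> B \<longrightarrow> T x y z \<longrightarrow> x \<in> A}" (is "_ = over_points ?C")
proof -
  have "{u \<in> carrier vectors. \<forall>w\<in>over_points B. star u w \<in> over_points A} = over_points ?C"
  proof (intro Set.set_eqI iffI)
    fix u assume u: "u \<in> {u \<in> carrier vectors. \<forall>w\<in>over_points B. star u w \<in> over_points A}"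
    then have uV: "u \<in> f ` supported (W \<times> W)" by simp
    have "x \<in> A" if s: "crd u s \<noteq> 0" and zx: "z \<in> W" "x \<in> W" "z \<in> B" "T x (fst s) z" for s z x
    proof -
      have sW: "s \<in> W \<times> W" using crd_zero_outside[OF uV s] .
      obtain t where t: "t \<in> W \<times> W" "fst t = z" "fst (p s t) = x"
        using p_solve_right[OF sW zx(1,2)] by blast
      have "star u (single t) \<in> over_points A"
        using u t zx by (simp add: single_mem_over_points)
      moreover have "crd (star u (single t)) (p s t) \<noteq> 0"
        using mul_single_right[OF sW t(1)] t zx s by simp
      ultimately show ?thesis using t(3) over_pointsD by blast
    qed
    then show "u \<in> over_points ?C"
      using uV crd_zero_outside[OF uV] by (force simp: mem_over_points)
  next
    fix u assume u: "u \<in> over_points ?C"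
    have "star u w \<in> over_points A" if w: "w \<in> over_points B" for w
      unfolding mem_over_points
    proof (intro conjI allI impI)
      show "star u w \<in> f ` supported (W \<times> W)" by (simp add: star_def)
    next
      fix b assume "crd (star u w) b \<noteq> 0"
      then have "mul (crd u) (crd w) b \<noteq> 0" by simp
      then obtain s t where st: "s \<in> W \<times> W" "t \<in> W \<times> W" "p s t = b" "T (fst b) (fst s) (fst t)"
        "crd u s \<noteq> 0" "crd w t \<noteq> 0" by (rule mul_nonzeroE)
      then have "fst s \<in> ?C" "fst t \<in> B" using u w over_pointsD by blast+
      moreover have "fst b \<in> W" using p_closed[OF st(1,2)] st(3) by auto
      ultimately show "fst b \<in> A" using st by auto
    qed
    then show "u \<in> {u \<in> carrier vectors. \<forall>w\<in>over_points B. star u w \<in> over_points A}"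
      using u by (simp add: mem_over_points)
  qed
  then show ?thesis by (simp only: over_sp_def span_over_points)
qed

lemma dia_sp_over_points:
  "dia_sp (over_points A) = over_points {x \<in> W. \<exists>y\<in>W. y \<in> A \<and> S x y}" (is "_ = over_points ?C")
proof -
  have "{v \<in> carrier vectors. \<exists>u\<in>over_points A. (v, u) \<in> acc} = over_points ?C"
  proof (intro Set.set_eqI iffI)
    fix v assume "v \<in> {v \<in> carrier vectors. \<exists>u\<in>over_points A. (v, u) \<in> acc}"
    then obtain u where u: "u \<in> over_points A" "(v, u) \<in> acc" by blast
    then have V: "u \<in> f ` supported (W \<times> W)" "v \<in> f ` supported (W \<times> W)"
      by (simp_all add: acc_def)
    have "fst b \<in> ?C" if b: "crd v b \<noteq> 0" for b
    proof -
      obtain c where c: "crd u c \<noteq> 0" "S (fst b) (fst c)" using accD[OF u(2) b] by blast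
      then have "fst c \<in> A" using u(1) over_pointsD by blast
      then show ?thesis
        using c crd_zero_outside[OF V(1) c(1)] crd_zero_outside[OF V(2) b] by auto
    qed
    then show "v \<in> over_points ?C" using V by (simp add: mem_over_points)
  next
    fix v assume v: "v \<in> over_points ?C"
    \<comment> \<open>The all-ones vector over \<open>A\<close> has the largest support available in
      \<open>over_points A\<close>, so this one witness serves every \<open>v\<close>.\<close>
    define \<phi> :: "'w \<times> 'w \<Rightarrow> 'a" where "\<phi> c = (if c \<in> W \<times> W \<and> fst c \<in> A then 1 else 0)" for c
    have \<phi>: "\<phi> \<in> supported (W \<times> W)" by (auto simp: supported_def \<phi>_def)
    have "f \<phi> \<in> over_points A" using \<phi> by (simp add: mem_over_points \<phi>_def)
    moreover have "(v, f \<phi>) \<in> acc"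
    proof -
      have "\<exists>c. \<phi> c \<noteq> 0 \<and> S (fst b) (fst c)" if b: "crd v b \<noteq> 0" for b
      proof -
        obtain y where "y \<in> W" "y \<in> A" "S (fst b) y" using over_pointsD[OF v b] by blast
        then show ?thesis by (intro exI[of _ "(y, y)"]) (simp add: \<phi>_def)
      qed
      then show ?thesis using v \<phi> by (simp add: acc_def mem_over_points)
    qed
    ultimately show "v \<in> {v \<in> carrier vectors. \<exists>u\<in>over_points A. (v, u) \<in> acc}"
      using v by (auto simp: mem_over_points)
  qed
  then show ?thesis by (simp only: dia_sp_def span_over_points)
qed

text \<open>The relation can be tested on basis vectors: one over \<open>x\<close> is related to
  \<open>u\<close> as soon as \<open>x\<close> sees the point of one index in the support of
  \<open>u\<close>.\<close>

lemma box_sp_over_points: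
  "box_sp (over_points A) = over_points {y \<in> W. \<forall>x\<in>W. S x y \<longrightarrow> x \<in> A}" (is "_ = over_points ?C")
proof -
  have "{u \<in> carrier vectors. \<forall>v. (v, u) \<in> acc \<longrightarrow> v \<in> over_points A} = over_points ?C"
  proof (intro Set.set_eqI iffI)
    fix u assume u: "u \<in> {u \<in> carrier vectors. \<forall>v. (v, u) \<in> acc \<longrightarrow> v \<in> over_points A}"
    then have uV: "u \<in> f ` supported (W \<times> W)" by simp
    have "x \<in> A" if c: "crd u c \<noteq> 0" and x: "x \<in> W" "S x (fst c)" for c x
    proof -
      have W: "(x, x) \<in> W \<times> W" using x by simp
      have "(single (x, x), u) \<in> acc"
        unfolding acc_def using uV c x single_closed[OF W] crd_single[OF W] by auto
      then have "single (x, x) \<in> over_points A" using u by blast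
      then show ?thesis using single_mem_over_points[OF W] by simp
    qed
    then show "u \<in> over_points ?C"
      using uV crd_zero_outside[OF uV] by (force simp: mem_over_points)
  next
    fix u assume u: "u \<in> over_points ?C"
    have "v \<in> over_points A" if v: "(v, u) \<in> acc" for v
    proof -
      have vV: "v \<in> f ` supported (W \<times> W)" using v by (simp add: acc_def)
      have "fst b \<in> A" if b: "crd v b \<noteq> 0" for b
      proof -
        obtain c where c: "crd u c \<noteq> 0" "S (fst b) (fst c)" using accD[OF v b] by blast
        then have "fst c \<in> ?C" using u over_pointsD by blast
        then show ?thesis using c crd_zero_outside[OF vV b] by auto
      qed
      then show ?thesis using vV by (simp add: mem_over_points)
    qed
    then show "u \<in> {u \<in> carrier vectors. \<forall>v. (v, u) \<in> acc \<longrightarrow> v \<in> over_points A}"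
      using u by (simp add: mem_over_points)
  qed
  then show ?thesis by (simp only: box_sp_def span_over_points)
qed

text \<open>\<open>over_points\<close> is a homomorphism from the complex algebra of the frame to
  the algebra of subspaces.\<close>

lemma fm_interp_over_points:
  "fm_interp (\<lambda>q. over_points (\<nu> q)) A = over_points (sat \<nu> A)"
  by (induction A) (simp_all add: tensor_sp_over_points under_sp_over_points
      over_sp_over_points dia_sp_over_points box_sp_over_points)

text \<open>Makes the homomorphism an order embedding, so a failure on the frame persists in the
  algebra. Points outside \<open>W\<close> index no basis vector, hence the restriction on
  \<open>A\<close>.\<close>

lemma over_points_subset_iff:
  assumes "A \<subseteq> W"
  shows "over_points A \<subseteq> over_points B \<longleftrightarrow> A \<subseteq> B"
proof
  assume AB: "over_points A \<subseteq> over_points B"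
  show "A \<subseteq> B"
  proof
    fix x assume x: "x \<in> A"
    then have W: "(x, x) \<in> W \<times> W" using assms by blast
    have "single (x, x) \<in> over_points A" using x by (simp add: single_mem_over_points[OF W])
    then have "single (x, x) \<in> over_points B" using AB by blast
    then show "x \<in> B" by (simp add: single_mem_over_points[OF W])
  qed
qed (use mem_over_points in blast)

lemma sat_subset: "(\<And>q. \<nu> q \<subseteq> W) \<Longrightarrow> sat \<nu> A \<subseteq> W"
  by (cases A) auto

lemma valuation_over_points: "valuation (\<lambda>q. over_points (\<nu> q))"
  by (simp add: valuation_def over_points_def subspace_sp)

end

section \<open>Completeness\<close>

theorem mainTheorem1:
  fixes X Y :: "'p struct"
  assumes "infinite (UNIV :: 'k set)" and "infinite (UNIV :: 'v set)"
    and "is_sequent X Y"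
    and "fin_dim_valid TYPE('k) TYPE('v) X Y"
  shows "X \<turnstile> Y"
proof (rule derivable_if_fm_of[OF assms(3)], rule ccontr)
  assume "\<not> Fm (fm_of X) \<turnstile> Fm (fm_of Y)"
  then obtain W :: "'p formula set set" and T S \<nu> where
    frame: "finite_frame W" and \<nu>: "\<And>q. \<nu> q \<subseteq> W" and
    refuted: "\<not> finite_frame.sat W T S \<nu> (fm_of X) \<subseteq> finite_frame.sat W T S \<nu> (fm_of Y)"
    by (rule finite_frame_completeness) (rule that)
  interpret finite_frame W T S by (rule frame)
  obtain p where p: "twisted_product W p" using twisted_product_exists[OF finite_W] ..
  obtain e\<^sub>0 :: "nat \<Rightarrow> 'k" where e\<^sub>0: "inj e\<^sub>0"
    using infinite_countable_subset[OF assms(1)] by blast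
  obtain f\<^sub>0 :: "nat \<Rightarrow> 'v" where f\<^sub>0: "inj f\<^sub>0"
    using infinite_countable_subset[OF assms(2)] by blast
  \<comment> \<open>Listing the indices turns a supported vector into a finite list of rationals, so
    there are only countably many.\<close>
  obtain bs where bs: "set bs = W \<times> W"
    using finite_list[OF finite_cartesian_product[OF finite_W finite_W]] by blast
  define e :: "rat \<Rightarrow> 'k" where "e = e\<^sub>0 \<circ> to_nat"
  define f :: "('p formula set \<times> 'p formula set \<Rightarrow> rat) \<Rightarrow> 'v"
    where "f \<phi> = f\<^sub>0 (to_nat (map \<phi> bs))" for \<phi>
  have e: "inj e" unfolding e_def by (intro inj_compose e\<^sub>0 inj_to_nat)
  \<comment> \<open>The list says nothing about values off \<open>W \<times> W\<close>; there both
    functions vanish, whence injectivity on supported functions.\<close>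
  have f: "inj_on f (supported (W \<times> W))"
  proof (rule inj_onI)
    fix \<phi> \<psi> :: "'p formula set \<times> 'p formula set \<Rightarrow> rat"
    assume supp: "\<phi> \<in> supported (W \<times> W)" "\<psi> \<in> supported (W \<times> W)" and "f \<phi> = f \<psi>"
    then have "map \<phi> bs = map \<psi> bs"
      using f\<^sub>0 by (simp add: f_def inj_eq del: map_eq_conv)
    then have "\<forall>b\<in>W \<times> W. \<phi> b = \<psi> b" by (simp only: map_eq_conv bs)
    moreover have "\<phi> b = \<psi> b" if "b \<notin> W \<times> W" for b
      using that supp unfolding supported_def by (metis (mono_tags, lifting) mem_Collect_eq)
    ultimately show "\<phi> = \<psi>" by blast
  qed
  interpret frame_algebra W T S p e f
    by (intro frame_algebra.intro coordinates.intro frame_algebra_axioms.intro frame p e f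
        finite_cartesian_product finite_W infinite_UNIV_char_0)
  have "models (\<lambda>q. over_points (\<nu> q)) X Y"
    using assms(4)[unfolded fin_dim_valid_def, rule_format,
        OF modal_K_algebra_vectors fin_dim_vectors valuation_over_points] .
  then have "sat \<nu> (fm_of X) \<subseteq> sat \<nu> (fm_of Y)"
    by (simp add: models_def interp_eq_fm_interp fm_interp_over_points
        over_points_subset_iff sat_subset \<nu>)
  with refuted show False ..
qed

end
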